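(* For every integer $d\ge 3$, the independence number of the Keller graph satisfies $\alpha(G_d)=2^d$; moreover $\alpha(G_2)=5$.
   Context: The Keller graph $G_d$ has as vertices the $4^d$ tuples in $\{0,1,2,3\}^d$; two tuples $u,v$ are adjacent iff they differ in at least two coordinates and there is at least one coordinate $i$ with $u_i-v_i\equiv 2\pmod 4$. $\alpha$ denotes the maximum size of an independent set. *)

theory Defs
  imports Complex_Main "HOL-Library.Ramsey" "HOL-Number_Theory.Cong"
begin

text \<open>A finite simple graph is given by its vertex set and its set of two-element edges,
  as for the library's \<^const>\<open>indep\<close>.\<close>

definition independence_number :: "'a set \<Rightarrow> 'a set set \<Rightarrow> nat"
  where "independence_number V E = Max {card S |S. S \<subseteq> V \<and> indep S E}"

text \<open>Coordinates are integers so that their differences do not truncate; the coordinates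
  are indexed from 0.\<close>

definition keller_verts :: "nat \<Rightarrow> int list set"
  where "keller_verts d = {u. length u = d \<and> set u \<subseteq> {0, 1, 2, 3}}"

definition keller_adj :: "nat \<Rightarrow> int list \<Rightarrow> int list \<Rightarrow> bool"
  where "keller_adj d u v \<longleftrightarrow>
    card {i. i < d \<and> u ! i \<noteq> v ! i} \<ge> 2 \<and> (\<exists>i<d. [u ! i - v ! i = 2] (mod 4))"

definition keller_edges :: "nat \<Rightarrow> int list set set"
  where "keller_edges d =
    {{u, v} |u v. u \<in> keller_verts d \<and> v \<in> keller_verts d \<and> keller_adj d u v}"

lemma finite_keller_verts [simp]: "finite (keller_verts d)"
  using finite_lists_length_eq [of "{0, 1, 2, 3::int}" d]
  by (simp add: keller_verts_def conj_commute)

lemma card_keller_verts: "card (keller_verts d) = 4 ^ d"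
  using card_lists_length_eq [of "{0, 1, 2, 3::int}" d]
  by (simp add: keller_verts_def conj_commute eval_nat_numeral)

lemma keller_adj_sym:
  assumes "keller_adj d u v"
  shows "keller_adj d v u"
proof -
  have "[b - a = 2] (mod 4)" if "[a - b = 2] (mod 4)" for a b :: int
    using that unfolding cong_def by presburger
  then show ?thesis
    using assms unfolding keller_adj_def by (auto simp: eq_commute)
qed

lemma keller_adj_irrefl: "\<not> keller_adj d u u"
  by (simp add: keller_adj_def)

lemma keller_edges_iff:
  "{u, v} \<in> keller_edges d \<longleftrightarrow>
    u \<in> keller_verts d \<and> v \<in> keller_verts d \<and> keller_adj d u v"
  by (auto simp: keller_edges_def doubleton_eq_iff intro: keller_adj_sym)

text \<open>On a finite vertex set the maximum is attained and bounds every independent set.\<close>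

lemma independence_number_eq_iff:
  assumes "finite V"
  shows "independence_number V E = k \<longleftrightarrow>
    (\<exists>S\<subseteq>V. indep S E \<and> card S = k) \<and> (\<forall>S\<subseteq>V. indep S E \<longrightarrow> card S \<le> k)"
proof -
  let ?A = "{card S |S. S \<subseteq> V \<and> indep S E}"
  have "?A \<subseteq> card ` Pow V" by auto
  then have "finite ?A"
    using assms by (meson finite_Pow_iff finite_imageI finite_subset)
  moreover have "?A \<noteq> {}" using null_indep by blast
  ultimately show ?thesis
    unfolding independence_number_def by (subst Max_eq_iff) auto
qed

end

theory Submission
  imports Defs
begin

text \<open>Slice an independent set \<open>S\<close> of the \<open>(d + 1)\<close>-dimensional graph by the first coordinate.
  Two elements in slices that differ by 2 mod 4 agree in the remaining coordinates, so opposite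
  slices are equal singletons unless one of them is empty. Hence \<open>S\<close> is essentially made of two
  slices \<open>A\<close>, \<open>B\<close>, which gives \<open>\<alpha>(d + 1) \<le> 2 \<alpha>(d)\<close>. In addition no element of \<open>A\<close>
  differs by 2 from an element of \<open>B\<close> in any coordinate, so the projections of \<open>A\<close> and \<open>B\<close> to
  a coordinate have at most 4 values in total. Counting with these projections starts the
  induction: it sharpens the bounds 8 and 10 for dimensions 2 and 3 to 5 and 8.\<close>

definition nowhere_opposite :: "nat \<Rightarrow> int list set \<Rightarrow> int list set \<Rightarrow> bool"
  where "nowhere_opposite d A B \<longleftrightarrow>
    (\<forall>u\<in>A. \<forall>v\<in>B. \<forall>i<d. \<not> [u ! i - v ! i = 2] (mod 4))"

section \<open>Adjacency and independence coordinate by coordinate\<close>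

lemma indep_keller_iff:
  assumes "S \<subseteq> keller_verts d"
  shows "indep S (keller_edges d) \<longleftrightarrow> (\<forall>u\<in>S. \<forall>v\<in>S. \<not> keller_adj d u v)"
proof -
  have "{u, v} \<in> keller_edges d \<longleftrightarrow> keller_adj d u v" if "u \<in> S" "v \<in> S" for u v
    using that assms by (simp add: keller_edges_iff subset_iff)
  \<comment> \<open>\<open>indep\<close> constrains distinct vertices only; irreflexivity covers
    equal ones.\<close>
  then show ?thesis
    using keller_adj_irrefl[of d] unfolding indep_def by metis
qed

lemma card_differences_Cons:
  "card {i. i < Suc d \<and> (a # u) ! i \<noteq> (b # v) ! i} =
    (if a = b then 0 else 1) + card {i. i < d \<and> u ! i \<noteq> v ! i}"
proof -
  have "{i. i < Suc d \<and> (a # u) ! i \<noteq> (b # v) ! i} =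
      (if a = b then {} else {0}) \<union> Suc ` {i. i < d \<and> u ! i \<noteq> v ! i}"
    by (auto simp: less_Suc_eq_0_disj)
  then show ?thesis
    by (simp add: card_image)
qed

lemma keller_adj_Cons:
  "keller_adj (Suc d) (a # u) (b # v) \<longleftrightarrow>
    (if a = b then 0 else 1) + card {i. i < d \<and> u ! i \<noteq> v ! i} \<ge> 2 \<and>
    ([a - b = 2] (mod 4) \<or> (\<exists>i<d. [u ! i - v ! i = 2] (mod 4)))"
  unfolding keller_adj_def card_differences_Cons by (auto simp: less_Suc_eq_0_disj)

lemma keller_adj_Cons_same: "keller_adj (Suc d) (a # u) (a # v) \<longleftrightarrow> keller_adj d u v"
  unfolding keller_adj_Cons by (simp add: keller_adj_def cong_def)

lemma card_differences_pos:
  assumes "i < d" "u ! i \<noteq> v ! i"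
  shows "card {i. i < d \<and> u ! i \<noteq> v ! i} \<ge> 1"
proof -
  have "{i. i < d \<and> u ! i \<noteq> v ! i} \<noteq> {}"
    using assms by blast
  then show ?thesis
    by (simp add: Suc_le_eq card_gt_0_iff)
qed

section \<open>Slicing along the first coordinate\<close>

text \<open>Each pair of opposite slices either has an empty member, so that the other carries the
  whole pair, or consists of two singletons. The disjuncts count the pairs of the second kind: none,
  one (then \<open>B\<close> is a singleton standing for 2 elements, and only
  \<open>B \<noteq> {}\<close> is recorded), or both.\<close>

lemma keller_indep_two_slices:
  assumes S: "S \<subseteq> keller_verts (Suc d)" "indep S (keller_edges (Suc d))"
  obtains A B where "A \<subseteq> keller_verts d" "B \<subseteq> keller_verts d"
    "indep A (keller_edges d)" "indep B (keller_edges d)" "nowhere_opposite d A B"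
    "card S \<le> card A + card B \<or> B \<noteq> {} \<and> card S \<le> card A + 2 \<or> card S \<le> 4"
proof -
  define T where "T c = {u. c # u \<in> S}" for c
  have nadj: "\<not> keller_adj (Suc d) (a # u) (b # v)" if "u \<in> T a" "v \<in> T b" for a b u v
    using that S indep_keller_iff[OF S(1)] by (auto simp: T_def)
  have T_verts: "T c \<subseteq> keller_verts d" for c
  proof
    fix u
    assume "u \<in> T c"
    then have "c # u \<in> keller_verts (Suc d)"
      using S(1) by (auto simp: T_def)
    then show "u \<in> keller_verts d"
      by (simp add: keller_verts_def)
  qed
  then have fin: "finite (T c)" for c
    using finite_keller_verts finite_subset by blast
  have T_indep: "indep (T c) (keller_edges d)" for c
    unfolding indep_keller_iff[OF T_verts]
    using nadj[of _ c _ c] unfolding keller_adj_Cons_same by blast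
  have opp: "nowhere_opposite d (T a) (T b)" if "a \<noteq> b" for a b
    unfolding nowhere_opposite_def
  proof (intro ballI allI impI notI)
    fix u v i
    assume uv: "u \<in> T a" "v \<in> T b" "i < d" and cong: "[u ! i - v ! i = 2] (mod 4)"
    have "u ! i \<noteq> v ! i"
      using cong by (auto simp: cong_def)
    then have "card {i. i < d \<and> u ! i \<noteq> v ! i} \<ge> 1"
      using card_differences_pos uv(3) by blast
    \<comment> \<open>The heads differ and so do the entries at \<open>i\<close>, which also supply
      the difference of 2.\<close>
    then have "keller_adj (Suc d) (a # u) (b # v)"
      unfolding keller_adj_Cons using uv(3) cong \<open>a \<noteq> b\<close> by auto
    then show False
      using nadj uv by blast
  qed
  have eq: "u = v" if "u \<in> T a" "v \<in> T b" "[a - b = 2] (mod 4)" for u v a b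
  proof (rule ccontr)
    assume "u \<noteq> v"
    moreover have "length u = d" "length v = d"
      using that T_verts by (auto simp: keller_verts_def)
    ultimately obtain i where "i < d" "u ! i \<noteq> v ! i"
      using nth_equalityI[of u v] by auto
    then have "card {i. i < d \<and> u ! i \<noteq> v ! i} \<ge> 1"
      by (rule card_differences_pos)
    moreover have "a \<noteq> b"
      using that(3) by (auto simp: cong_def)
    \<comment> \<open>Now the heads supply the difference of 2, and \<open>i\<close> is the second
      place of difference.\<close>
    ultimately have "keller_adj (Suc d) (a # u) (b # v)"
      unfolding keller_adj_Cons using that(3) by simp
    then show False
      using nadj that by blast
  qed
  have pair: "\<exists>c\<in>{a, b}. card (T a) + card (T b) \<le> card (T c) \<or>
      card (T c) = 1 \<and> card (T a) + card (T b) \<le> 2" if "[a - b = 2] (mod 4)" for a b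
  proof (cases "T a = {} \<or> T b = {}")
    case False
    then obtain u v where uv: "u \<in> T a" "v \<in> T b"
      by blast
    then have "T a = {u}" "T b = {v}"
      using eq that by blast+
    then show ?thesis
      by simp
  qed auto
  have "S \<subseteq> (\<Union>c\<in>{0, 1, 2, 3}. (#) c ` T c)"
  proof
    fix w
    assume w: "w \<in> S"
    with S(1) have "length w = Suc d" "set w \<subseteq> {0, 1, 2, 3}"
      by (auto simp: keller_verts_def)
    then obtain c u where "w = c # u" "c \<in> {0, 1, 2, 3}"
      by (cases w) auto
    then show "w \<in> (\<Union>c\<in>{0, 1, 2, 3}. (#) c ` T c)"
      using w by (auto simp: T_def)
  qed
  then have "card S \<le> card (\<Union>c\<in>{0, 1, 2, 3}. (#) c ` T c)"
    by (rule card_mono[rotated]) (use fin in auto)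
  also have "\<dots> \<le> (\<Sum>c\<in>{0, 1, 2, 3}. card ((#) c ` T c))"
    by (rule card_UN_le) simp
  also have "\<dots> = (\<Sum>c\<in>{0, 1, 2, 3}. card (T c))"
    by (simp add: card_image)
  finally have card_S: "card S \<le> (card (T 2) + card (T 0)) + (card (T 3) + card (T 1))"
    by simp
  have opposite: "[2 - 0 = 2 :: int] (mod 4)" "[3 - 1 = 2 :: int] (mod 4)"
    by simp_all
  obtain a where a: "a \<in> {2, 0}" "card (T 2) + card (T 0) \<le> card (T a) \<or>
      card (T a) = 1 \<and> card (T 2) + card (T 0) \<le> 2"
    using pair[OF opposite(1)] by blast
  obtain b where b: "b \<in> {3, 1}" "card (T 3) + card (T 1) \<le> card (T b) \<or>
      card (T b) = 1 \<and> card (T 3) + card (T 1) \<le> 2"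
    using pair[OF opposite(2)] by blast
  have ab: "nowhere_opposite d (T a) (T b)" "nowhere_opposite d (T b) (T a)"
    using a(1) b(1) by (auto intro!: opp)
  have "T a \<noteq> {}" if "card (T a) = 1"
    using that by auto
  moreover have "T b \<noteq> {}" if "card (T b) = 1"
    using that by auto
  \<comment> \<open>The middle disjunct is not symmetric, so the case where the pair of
    \<open>a\<close> is the singleton pair is kept apart and settled by swapping the two
    slices.\<close>
  ultimately consider "card S \<le> card (T a) + card (T b) \<or> T b \<noteq> {} \<and> card S \<le> card (T a) + 2 \<or> card S \<le> 4"
    | "T a \<noteq> {} \<and> card S \<le> card (T b) + 2"
    using a(2) b(2) card_S by linarith
  then show thesis
  proof cases
    case 1
    then show ?thesis
      by (rule that[OF T_verts T_verts T_indep T_indep ab(1)])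
  next
    case 2
    then have "card S \<le> card (T b) + card (T a) \<or> T a \<noteq> {} \<and> card S \<le> card (T b) + 2 \<or> card S \<le> 4"
      by blast
    then show ?thesis
      by (rule that[OF T_verts T_verts T_indep T_indep ab(2)])
  qed
qed

section \<open>Counting with projections\<close>

text \<open>Shifting by 2 mod 4 is injective and moves the values of \<open>B\<close> off those of
  \<open>A\<close>, so both sets of values fit disjointly into the four residues.\<close>

lemma nowhere_opposite_card_projections:
  assumes "A \<subseteq> keller_verts d" "B \<subseteq> keller_verts d" "nowhere_opposite d A B" "i < d"
  shows "card ((\<lambda>u. u ! i) ` A) + card ((\<lambda>u. u ! i) ` B) \<le> 4"
proof -
  let ?P = "(\<lambda>u. u ! i) ` A" and ?Q = "(\<lambda>u. u ! i) ` B"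
  let ?h = "\<lambda>x::int. (x + 2) mod 4"
  have coord: "u ! i \<in> {0, 1, 2, 3}" if "u \<in> keller_verts d" for u
  proof -
    have "u ! i \<in> set u" "set u \<subseteq> {0, 1, 2, 3}"
      using that assms(4) by (simp_all add: keller_verts_def)
    then show ?thesis
      by (rule subsetD[rotated])
  qed
  have P: "?P \<subseteq> {0, 1, 2, 3}" and Q: "?Q \<subseteq> {0, 1, 2, 3}"
    using assms(1,2) by (auto simp del: insert_iff intro!: coord)
  have fin: "finite ?P" "finite ?Q"
    using finite_subset[OF P] finite_subset[OF Q] by simp_all
  have "inj_on ?h {0, 1, 2, 3}"
    by (auto simp: inj_on_def)
  then have inj: "inj_on ?h ?Q"
    using Q by (rule inj_on_subset)
  have "?P \<inter> ?h ` ?Q = {}"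
  proof -
    have "[a - b = 2] (mod 4)" if "a = (b + 2) mod 4" for a b :: int
      using that unfolding cong_def by presburger
    then show ?thesis
      using assms(3,4) unfolding nowhere_opposite_def by blast
  qed
  then have "card ?P + card ?Q = card (?P \<union> ?h ` ?Q)"
    using fin by (simp add: card_Un_disjoint card_image[OF inj])
  also have "\<dots> \<le> card {0, 1, 2, 3::int}"
    using P Q by (intro card_mono) auto
  finally show ?thesis
    by simp
qed

lemma card_le_projection_1:
  assumes "A \<subseteq> keller_verts 1"
  shows "card A \<le> card ((\<lambda>u. u ! 0) ` A)"
proof -
  have "length u = 1" if "u \<in> A" for u
    using that assms by (auto simp: keller_verts_def)
  then have "inj_on (\<lambda>u. u ! 0) A"
    by (intro inj_onI nth_equalityI) simp_all
  then show ?thesis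
    by (simp add: card_image)
qed

lemma card_le_projections_2:
  assumes "A \<subseteq> keller_verts 2"
  shows "card A \<le> card ((\<lambda>u. u ! 0) ` A) * card ((\<lambda>u. u ! 1) ` A)"
proof -
  have "length u = 2" if "u \<in> A" for u
    using that assms by (auto simp: keller_verts_def)
  then have "inj_on (\<lambda>u. (u ! 0, u ! 1)) A"
    by (intro inj_onI nth_equalityI) (auto simp: less_2_cases_iff)
  then have "card A = card ((\<lambda>u. (u ! 0, u ! 1)) ` A)"
    by (simp add: card_image)
  also have "\<dots> \<le> card ((\<lambda>u. u ! 0) ` A \<times> (\<lambda>u. u ! 1) ` A)"
    using assms finite_subset[OF _ finite_keller_verts] by (intro card_mono) auto
  finally show ?thesis
    by (simp add: card_cartesian_product)
qed

section \<open>Upper bounds\<close>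

lemma keller_indep_2_le:
  assumes "S \<subseteq> keller_verts 2" "indep S (keller_edges 2)"
  shows "card S \<le> 5"
proof -
  have "S \<subseteq> keller_verts (Suc 1)" "indep S (keller_edges (Suc 1))"
    using assms unfolding Suc_1 .
  then obtain A B where "A \<subseteq> keller_verts 1" "B \<subseteq> keller_verts 1"
    "indep A (keller_edges 1)" "indep B (keller_edges 1)" "nowhere_opposite 1 A B"
    and S: "card S \<le> card A + card B \<or> B \<noteq> {} \<and> card S \<le> card A + 2 \<or> card S \<le> 4"
    by (rule keller_indep_two_slices)
  then have AB: "A \<subseteq> keller_verts 1" "B \<subseteq> keller_verts 1" "nowhere_opposite 1 A B"
    by simp_all
  have "card A + card B \<le> 4"
    using nowhere_opposite_card_projections[OF AB, of 0]
      card_le_projection_1[OF AB(1)] card_le_projection_1[OF AB(2)] by linarith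
  \<comment> \<open>A nonempty \<open>B\<close> leaves at most 3 elements for \<open>A\<close>, so
    the singleton pair case gives 3 + 2 = 5.\<close>
  moreover have "card B \<ge> 1" if "B \<noteq> {}"
    using that finite_subset[OF AB(2)] by (simp add: Suc_le_eq card_gt_0_iff)
  ultimately show ?thesis
    using S by linarith
qed

text \<open>Here \<open>p\<close>, \<open>q\<close> and \<open>p'\<close>, \<open>q'\<close> stand
  for the sizes of the projections of two planar slices. Two 2 by 2 rectangles reach 8. The caps of
  5 exclude larger totals such as 9 + 1 from sides 3, 3 and 1, 1, or 16 + 0.\<close>

lemma rectangles_bound:
  fixes a b :: nat
  assumes "a \<le> p * q" "b \<le> p' * q'" "p + p' \<le> 4" "q + q' \<le> 4" "a \<le> 5" "b \<le> 5"
  shows "a + b \<le> 8"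
proof (rule ccontr)
  assume *: "\<not> a + b \<le> 8"
  have "p \<in> {0, 1, 2, 3, 4}" "q \<in> {0, 1, 2, 3, 4}"
    using assms by auto
  \<comment> \<open>Eliminating \<open>p'\<close> and \<open>q'\<close> leaves 25 pairs
    \<open>p\<close>, \<open>q\<close> to check.\<close>
  moreover have "b \<le> (4 - p) * (4 - q)"
    using assms(2) mult_le_mono[of p' "4 - p" q' "4 - q"] assms(3,4) by linarith
  ultimately show False
    using * assms(1,5,6) by auto
qed

lemma keller_indep_3_le:
  assumes "S \<subseteq> keller_verts 3" "indep S (keller_edges 3)"
  shows "card S \<le> 8"
proof -
  have "Suc 2 = 3"
    by simp
  then have "S \<subseteq> keller_verts (Suc 2)" "indep S (keller_edges (Suc 2))"
    using assms by simp_all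
  then obtain A B where AB: "A \<subseteq> keller_verts 2" "B \<subseteq> keller_verts 2"
    and indep: "indep A (keller_edges 2)" "indep B (keller_edges 2)"
    and opp: "nowhere_opposite 2 A B"
    and S: "card S \<le> card A + card B \<or> B \<noteq> {} \<and> card S \<le> card A + 2 \<or> card S \<le> 4"
    by (rule keller_indep_two_slices)
  have "card A \<le> 5" "card B \<le> 5"
    using AB indep by (simp_all add: keller_indep_2_le)
  moreover from this have "card A + card B \<le> 8"
    using rectangles_bound[OF card_le_projections_2[OF AB(1)] card_le_projections_2[OF AB(2)]]
      nowhere_opposite_card_projections[OF AB opp] by simp
  \<comment> \<open>The cases with singleton pairs give at most 5 + 2 = 7 and 4.\<close>
  ultimately show ?thesis
    using S by linarith
qed

lemma keller_indep_le:
  assumes "d \<ge> 3" "S \<subseteq> keller_verts d" "indep S (keller_edges d)"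
  shows "card S \<le> 2 ^ d"
  using assms
proof (induction d arbitrary: S rule: nat_induct_at_least)
  case base
  then show ?case
    using keller_indep_3_le by simp
next
  case (Suc d)
  obtain A B where "A \<subseteq> keller_verts d" "B \<subseteq> keller_verts d"
    "indep A (keller_edges d)" "indep B (keller_edges d)"
    and S: "card S \<le> card A + card B \<or> B \<noteq> {} \<and> card S \<le> card A + 2 \<or> card S \<le> 4"
    by (rule keller_indep_two_slices[OF Suc.prems])
  then have "card A \<le> 2 ^ d" "card B \<le> 2 ^ d"
    using Suc.IH by simp_all
  \<comment> \<open>This makes the bounds from singleton pairs, \<open>2 ^ d + 2\<close> and 4,
    smaller than \<open>2 ^ Suc d\<close>.\<close>
  moreover have "(2::nat) ^ 3 \<le> 2 ^ d"
    using Suc.hyps by (intro power_increasing) auto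
  ultimately show ?case
    using S by auto
qed

section \<open>Independent sets attaining the bounds\<close>

text \<open>Entries from 0 and 1 differ by -1, 0 or 1, never by 2 mod 4, so all the 0-1 tuples are
  pairwise nonadjacent.\<close>

lemma keller_indep_zero_one:
  "\<exists>S\<subseteq>keller_verts d. indep S (keller_edges d) \<and> card S = 2 ^ d"
proof -
  let ?S = "{u::int list. set u \<subseteq> {0, 1} \<and> length u = d}"
  have S: "?S \<subseteq> keller_verts d"
    by (auto simp: keller_verts_def)
  have coord: "u ! i \<in> {0, 1}" if "u \<in> ?S" "i < d" for u i
  proof -
    have "u ! i \<in> set u" "set u \<subseteq> {0, 1}"
      using that by simp_all
    then show ?thesis
      by (rule subsetD[rotated])
  qed
  have "\<not> keller_adj d u v" if uv: "u \<in> ?S" "v \<in> ?S" for u v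
  proof -
    have "\<not> [u ! i - v ! i = 2] (mod 4)" if "i < d" for i
      using coord[OF uv(1) that] coord[OF uv(2) that] by (auto simp: cong_def)
    then show ?thesis
      unfolding keller_adj_def by simp
  qed
  then have "indep ?S (keller_edges d)"
    unfolding indep_keller_iff[OF S] by simp
  moreover have "card ?S = 2 ^ d"
    using card_lists_length_eq[of "{0, 1::int}" d] by (simp add: numeral_2_eq_2)
  ultimately show ?thesis
    using S by blast
qed

lemma keller_indep_five:
  "\<exists>S\<subseteq>keller_verts 2. indep S (keller_edges 2) \<and> card S = 5"
proof -
  \<comment> \<open>A cross in the 4 by 4 torus with centre \<open>[0, 1]\<close>: only opposite
    arms differ by 2 in a coordinate, and they agree in the other one. Its slices have sizes 3, 1
    and 1, the extremal case of the upper bound.\<close>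
  let ?S = "{[0, 0], [0, 2], [3, 1], [0, 1], [1, 1]} :: int list set"
  have S: "?S \<subseteq> keller_verts 2"
    by (auto simp: keller_verts_def)
  \<comment> \<open>Behind the first coordinate only one index remains, so vertices with equal heads
    cannot differ twice.\<close>
  have "\<not> 2 \<le> card {i::nat. i = 0 \<and> P i}" for P
  proof -
    have "card {i::nat. i = 0 \<and> P i} \<le> card {0::nat}"
      by (rule card_mono) auto
    then show ?thesis
      by simp
  qed
  then have "\<not> keller_adj (Suc (Suc 0)) u v" if "u \<in> ?S" "v \<in> ?S" for u v
    using that by (auto simp: keller_adj_Cons card_differences_Cons cong_def)
  then have "indep ?S (keller_edges 2)"
    unfolding indep_keller_iff[OF S] by (simp add: numeral_2_eq_2)
  moreover have "card ?S = 5"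
    by simp
  ultimately show ?thesis
    using S by blast
qed

theorem theorem19:
  shows "(\<forall>d::nat. d \<ge> 3 \<longrightarrow> independence_number (keller_verts d) (keller_edges d) = 2 ^ d)
    \<and> independence_number (keller_verts 2) (keller_edges 2) = 5"
  using keller_indep_le keller_indep_zero_one keller_indep_2_le keller_indep_five
  by (simp add: independence_number_eq_iff)

end
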